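(* Let $\mu=\mu_1\otimes\cdots\otimes\mu_n$ be any product probability measure on $\Omega^n$, where $\Omega$ is a Polish space. Then for any $f:\Omega^n\to\mathcal{H}_d$ whose matrix coefficients belong to $L^2(\mu)$, $$\mathrm{Var}_\mu(f)\preceq\mathcal{E}(f),$$ where $$\mathcal{E}(f)=\sum_{i=1}^n\int\bigg(f(x_1,\dots,x_n)-\int f(x_1,\dots,x_{i-1},z,x_{i+1},\dots,x_n)\,d\mu_i(z)\bigg)^2d\mu(x).$$
   Context: $\mathcal{H}_d$ is the set of $d\times d$ Hermitian matrices, $\preceq$ is the positive semi-definite order; integrals of matrix-valued functions are entrywise, squares are matrix squares, and $\mathrm{Var}_\mu(f)=\mathbb{E}_\mu[f^2]-(\mathbb{E}_\mu f)^2$. ($\mathcal{E}$ is the matrix Dirichlet form of the Markov process on $\Omega^n$ in which each coordinate $i$ is independently resampled from $\mu_i$ at the jump times of a rate-1 Poisson process.) *)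

theory Defs
  imports "HOL-Probability.Probability"
begin

text \<open>
  The index type \<open>'d\<close> plays the role of \<open>{1,...,d}\<close>, with \<open>d = CARD('d)\<close>.
\<close>

definition hermitian_mats :: "(complex ^ 'd ^ 'd) set" where
  "hermitian_mats = {A. \<forall>i j. A $ i $ j = cnj (A $ j $ i)}"

text \<open>
  Only the real part of \<open>v\<^sup>* A v\<close> is constrained: for Hermitian \<open>A\<close> that number is real anyway.
\<close>

definition pos_semidef :: "complex ^ 'd ^ 'd \<Rightarrow> bool" where
  "pos_semidef A \<longleftrightarrow> A \<in> hermitian_mats \<and>
     (\<forall>v :: complex ^ 'd. 0 \<le> Re (\<Sum>i\<in>UNIV. cnj (v $ i) * (A *v v) $ i))"

text \<open>The positive semi-definite order, as a relation on Hermitian matrices only.\<close>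

definition psd_le :: "complex ^ 'd ^ 'd \<Rightarrow> complex ^ 'd ^ 'd \<Rightarrow> bool" (infix "\<preceq>" 50) where
  "A \<preceq> B \<longleftrightarrow> A \<in> hermitian_mats \<and> B \<in> hermitian_mats \<and> pos_semidef (B - A)"

text \<open>
  The product \<open>*\<close> and the power \<open>^\<close> on \<open>complex ^ 'd ^ 'd\<close> are componentwise;
  the matrix product is \<open>**\<close>.
\<close>

definition mat_sq :: "complex ^ 'd ^ 'd \<Rightarrow> complex ^ 'd ^ 'd" where
  "mat_sq A = A ** A"

definition mat_integral :: "'b measure \<Rightarrow> ('b \<Rightarrow> complex ^ 'd ^ 'd) \<Rightarrow> complex ^ 'd ^ 'd" where
  "mat_integral M F = (\<chi> i j. \<integral>x. F x $ i $ j \<partial>M)"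

definition in_L2 :: "'b measure \<Rightarrow> ('b \<Rightarrow> complex) \<Rightarrow> bool" where
  "in_L2 M g \<longleftrightarrow> g \<in> borel_measurable M \<and> integrable M (\<lambda>x. (norm (g x))\<^sup>2)"

definition mat_var :: "'b measure \<Rightarrow> ('b \<Rightarrow> complex ^ 'd ^ 'd) \<Rightarrow> complex ^ 'd ^ 'd" where
  "mat_var M F = mat_integral M (\<lambda>x. mat_sq (F x)) - mat_sq (mat_integral M F)"

text \<open>
  A point \<open>(x\<^sub>1,...,x\<^sub>n)\<close> of \<open>\<Omega>\<^sup>n\<close> is a function in \<open>{1..n} \<rightarrow>\<^sub>E UNIV\<close>;
  \<open>x(i := z)\<close> replaces its \<open>i\<close>-th coordinate by \<open>z\<close>.
\<close>

definition mat_dirichlet ::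
  "nat \<Rightarrow> (nat \<Rightarrow> 'a measure) \<Rightarrow> ((nat \<Rightarrow> 'a) \<Rightarrow> complex ^ 'd ^ 'd) \<Rightarrow> complex ^ 'd ^ 'd" where
  "mat_dirichlet n \<mu> f =
     (\<Sum>i = 1..n. mat_integral (Pi\<^sub>M {1..n} \<mu>)
        (\<lambda>x. mat_sq (f x - mat_integral (\<mu> i) (\<lambda>z. f (x(i := z))))))"

end

theory Submission
  imports Defs
begin

text \<open>
  For Hermitian \<open>A\<close> one has \<open>v\<^sup>* A\<^sup>2 v = \<Sum>\<^sub>k |(A v)\<^sub>k|\<^sup>2\<close>, so testing both sides against \<open>v\<close>
  reduces the claim to the scalar Efron--Stein inequality for the real and imaginary parts of
  the functions \<open>x \<mapsto> (f x v)\<^sub>k\<close>. That inequality goes by induction on the set of coordinates: variance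
  is subadditive over a product of two spaces, and the induction hypothesis is applied to
  almost every slice, so only Fubini for two factors is needed.
\<close>

section \<open>Real square-integrable functions\<close>

lemma integrable_mult_square_integrable:
  fixes f g :: "'a \<Rightarrow> real"
  assumes [measurable]: "f \<in> borel_measurable M" "g \<in> borel_measurable M"
    and "integrable M (\<lambda>x. (f x)\<^sup>2)" "integrable M (\<lambda>x. (g x)\<^sup>2)"
  shows "integrable M (\<lambda>x. f x * g x)"
proof (rule Bochner_Integration.integrable_bound)
  show "integrable M (\<lambda>x. (f x)\<^sup>2 + (g x)\<^sup>2)"
    using assms by simp
  show "AE x in M. norm (f x * g x) \<le> norm ((f x)\<^sup>2 + (g x)\<^sup>2)"
  proof (rule AE_I2)
    fix x
    have "2 * (\<bar>f x\<bar> * \<bar>g x\<bar>) \<le> (f x)\<^sup>2 + (g x)\<^sup>2"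
      using sum_squares_bound[of "\<bar>f x\<bar>" "\<bar>g x\<bar>"] by (simp add: mult.assoc)
    then show "norm (f x * g x) \<le> norm ((f x)\<^sup>2 + (g x)\<^sup>2)"
      by (simp add: abs_mult) (smt (verit) mult_nonneg_nonneg abs_ge_zero)
  qed
qed simp

lemma square_integrable_diff:
  fixes f g :: "'a \<Rightarrow> real"
  assumes [measurable]: "f \<in> borel_measurable M" "g \<in> borel_measurable M"
    and "integrable M (\<lambda>x. (f x)\<^sup>2)" "integrable M (\<lambda>x. (g x)\<^sup>2)"
  shows "integrable M (\<lambda>x. (f x - g x)\<^sup>2)"
  using assms integrable_mult_square_integrable[OF assms]
  by (simp add: power2_diff mult.assoc)

text \<open>Jensen for the square, read off from the nonnegativity of the variance. It keeps
  marginals of square-integrable functions square-integrable.\<close>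

lemma (in prob_space) square_expectation_le:
  fixes f :: "'a \<Rightarrow> real"
  assumes "f \<in> borel_measurable M" "integrable M (\<lambda>x. (f x)\<^sup>2)"
  shows "(expectation f)\<^sup>2 \<le> expectation (\<lambda>x. (f x)\<^sup>2)"
  using variance_positive[of f] assms
  by (subst (asm) variance_eq) (auto intro: square_integrable_imp_integrable)

section \<open>Marginals on a product of two probability spaces\<close>

context pair_prob_space
begin

lemma integrable_comp_fst:
  fixes f :: "'a \<Rightarrow> real"
  assumes "integrable M1 f"
  shows "integrable (M1 \<Otimes>\<^sub>M M2) (\<lambda>p. f (fst p))" "(\<integral>p. f (fst p) \<partial>(M1 \<Otimes>\<^sub>M M2)) = (\<integral>x. f x \<partial>M1)"
proof -
  show 1: "integrable (M1 \<Otimes>\<^sub>M M2) (\<lambda>p. f (fst p))"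
  proof (rule Fubini_integrable)
    show "(\<lambda>p. f (fst p)) \<in> borel_measurable (M1 \<Otimes>\<^sub>M M2)"
      using assms by measurable
  qed (use assms in \<open>auto simp: M2.prob_space\<close>)
  show "(\<integral>p. f (fst p) \<partial>(M1 \<Otimes>\<^sub>M M2)) = (\<integral>x. f x \<partial>M1)"
    using integral_fst'[OF 1] by (simp add: M2.prob_space)
qed

lemma integrable_comp_snd:
  fixes f :: "'b \<Rightarrow> real"
  assumes "integrable M2 f"
  shows "integrable (M1 \<Otimes>\<^sub>M M2) (\<lambda>p. f (snd p))" "(\<integral>p. f (snd p) \<partial>(M1 \<Otimes>\<^sub>M M2)) = (\<integral>x. f x \<partial>M2)"
proof -
  show 1: "integrable (M1 \<Otimes>\<^sub>M M2) (\<lambda>p. f (snd p))"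
  proof (rule Fubini_integrable)
    show "(\<lambda>p. f (snd p)) \<in> borel_measurable (M1 \<Otimes>\<^sub>M M2)"
      using assms by measurable
  qed (use assms in \<open>auto\<close>)
  show "(\<integral>p. f (snd p) \<partial>(M1 \<Otimes>\<^sub>M M2)) = (\<integral>x. f x \<partial>M2)"
    using integral_fst'[OF 1] by (simp add: M1.prob_space)
qed

context
  fixes G :: "'a \<times> 'b \<Rightarrow> real"
  assumes G[measurable]: "G \<in> borel_measurable (M1 \<Otimes>\<^sub>M M2)"
    and G2: "integrable (M1 \<Otimes>\<^sub>M M2) (\<lambda>p. (G p)\<^sup>2)"
begin

text \<open>Jensen on a slice bounds the squared marginal by the marginal of the square, which is
  integrable by Fubini. The slices are square-integrable only for almost every \<open>x\<close>, so
  the bound is an almost-everywhere one.\<close>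

lemma square_integrable_marginal_fst:
  "integrable M1 (\<lambda>x. (\<integral>y. G (x, y) \<partial>M2)\<^sup>2)"
proof (rule Bochner_Integration.integrable_bound)
  show "integrable M1 (\<lambda>x. \<integral>y. (G (x, y))\<^sup>2 \<partial>M2)"
    using integrable_fst'[OF G2] .
  show "AE x in M1. norm ((\<integral>y. G (x, y) \<partial>M2)\<^sup>2) \<le> norm (\<integral>y. (G (x, y))\<^sup>2 \<partial>M2)"
    using AE_integrable_fst'[OF G2] AE_space
  proof eventually_elim
    case (elim x)
    have "(\<lambda>y. G (x, y)) \<in> borel_measurable M2"
      using elim by measurable
    then show ?case
      using M2.square_expectation_le[of "\<lambda>y. G (x, y)"] elim by simp
  qed
qed measurable

text \<open>The marginal is a conditional expectation: it depends on the first coordinate only, so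
  it comes out of the inner integral, which then yields a second copy of it.\<close>

lemma integral_mult_marginal_fst:
  "integrable (M1 \<Otimes>\<^sub>M M2) (\<lambda>p. G p * (\<integral>y. G (fst p, y) \<partial>M2))"
  "(\<integral>p. G p * (\<integral>y. G (fst p, y) \<partial>M2) \<partial>(M1 \<Otimes>\<^sub>M M2)) = (\<integral>x. (\<integral>y. G (x, y) \<partial>M2)\<^sup>2 \<partial>M1)"
proof -
  show 1: "integrable (M1 \<Otimes>\<^sub>M M2) (\<lambda>p. G p * (\<integral>y. G (fst p, y) \<partial>M2))"
    by (rule integrable_mult_square_integrable)
      (use G2 integrable_comp_fst(1)[OF square_integrable_marginal_fst] in auto)
  show "(\<integral>p. G p * (\<integral>y. G (fst p, y) \<partial>M2) \<partial>(M1 \<Otimes>\<^sub>M M2)) = (\<integral>x. (\<integral>y. G (x, y) \<partial>M2)\<^sup>2 \<partial>M1)"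
    using integral_fst'[OF 1] by (simp add: power2_eq_square)
qed

end

lemma swap_square_integrable:
  fixes G :: "'a \<times> 'b \<Rightarrow> real"
  assumes [measurable]: "G \<in> borel_measurable (M1 \<Otimes>\<^sub>M M2)"
    and "integrable (M1 \<Otimes>\<^sub>M M2) (\<lambda>p. (G p)\<^sup>2)"
  shows "integrable (M2 \<Otimes>\<^sub>M M1) (\<lambda>p. (G (snd p, fst p))\<^sup>2)"
  using integrable_product_swap[OF assms(2)] by (simp add: case_prod_unfold)

lemma integral_swap:
  fixes G :: "'a \<times> 'b \<Rightarrow> real"
  assumes [measurable]: "G \<in> borel_measurable (M1 \<Otimes>\<^sub>M M2)"
  shows "(\<integral>p. G (snd p, fst p) \<partial>(M2 \<Otimes>\<^sub>M M1)) = (\<integral>p. G p \<partial>(M1 \<Otimes>\<^sub>M M2))"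
  using integral_product_swap[OF assms] by (simp add: case_prod_unfold)

context
  fixes G :: "'a \<times> 'b \<Rightarrow> real"
  assumes G[measurable]: "G \<in> borel_measurable (M1 \<Otimes>\<^sub>M M2)"
    and G2: "integrable (M1 \<Otimes>\<^sub>M M2) (\<lambda>p. (G p)\<^sup>2)"
begin

interpretation swap: pair_prob_space M2 M1 ..

text \<open>Results on the second marginal come from those on the first one, applied to
  \<open>\<lambda>p. G (snd p, fst p)\<close> on the exchanged product.\<close>

lemma square_integrable_marginal_snd:
  "integrable M2 (\<lambda>y. (\<integral>x. G (x, y) \<partial>M1)\<^sup>2)"
  using swap.square_integrable_marginal_fst[of "\<lambda>p. G (snd p, fst p)"] swap_square_integrable[OF G G2]
  by simp

lemma integral_mult_marginal_snd:
  "integrable (M1 \<Otimes>\<^sub>M M2) (\<lambda>p. G p * (\<integral>x. G (x, snd p) \<partial>M1))"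
  "(\<integral>p. G p * (\<integral>x. G (x, snd p) \<partial>M1) \<partial>(M1 \<Otimes>\<^sub>M M2)) = (\<integral>y. (\<integral>x. G (x, y) \<partial>M1)\<^sup>2 \<partial>M2)"
proof -
  show "integrable (M1 \<Otimes>\<^sub>M M2) (\<lambda>p. G p * (\<integral>x. G (x, snd p) \<partial>M1))"
    by (rule integrable_mult_square_integrable)
      (use G2 integrable_comp_snd(1)[OF square_integrable_marginal_snd] in auto)
  show "(\<integral>p. G p * (\<integral>x. G (x, snd p) \<partial>M1) \<partial>(M1 \<Otimes>\<^sub>M M2)) = (\<integral>y. (\<integral>x. G (x, y) \<partial>M1)\<^sup>2 \<partial>M2)"
    using swap.integral_mult_marginal_fst(2)[of "\<lambda>p. G (snd p, fst p)"] swap_square_integrable[OF G G2]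
      integral_swap[of "\<lambda>p. G p * (\<integral>x. G (x, snd p) \<partial>M1)"]
    by simp
qed

text \<open>Pythagoras for the projection onto functions of the second coordinate: the cross term
  equals twice the squared norm of the projection. In the induction this evaluates the Dirichlet
  term of the new coordinate.\<close>

lemma integral_square_diff_marginal_snd:
  "(\<integral>p. (G p - (\<integral>x. G (x, snd p) \<partial>M1))\<^sup>2 \<partial>(M1 \<Otimes>\<^sub>M M2))
    = (\<integral>p. (G p)\<^sup>2 \<partial>(M1 \<Otimes>\<^sub>M M2)) - (\<integral>y. (\<integral>x. G (x, y) \<partial>M1)\<^sup>2 \<partial>M2)"
  using G2 integral_mult_marginal_snd integrable_comp_snd[OF square_integrable_marginal_snd]
  by (simp add: power2_diff mult.assoc)

text \<open>The difference of the two sides is the integral of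
  \<open>(G (x, y) - h x - k y + m)\<^sup>2\<close>, where \<open>h\<close>, \<open>k\<close>, \<open>m\<close> are the marginals and the mean.\<close>

lemma marginal_squares_le:
  "(\<integral>x. (\<integral>y. G (x, y) \<partial>M2)\<^sup>2 \<partial>M1) + (\<integral>y. (\<integral>x. G (x, y) \<partial>M1)\<^sup>2 \<partial>M2)
    \<le> (\<integral>p. (G p)\<^sup>2 \<partial>(M1 \<Otimes>\<^sub>M M2)) + (\<integral>p. G p \<partial>(M1 \<Otimes>\<^sub>M M2))\<^sup>2"
proof -
  define h where "h = (\<lambda>x. \<integral>y. G (x, y) \<partial>M2)"
  define k where "k = (\<lambda>y. \<integral>x. G (x, y) \<partial>M1)"
  define m where "m = (\<integral>p. G p \<partial>(M1 \<Otimes>\<^sub>M M2))"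
  let ?P = "M1 \<Otimes>\<^sub>M M2"
  have [measurable]: "h \<in> borel_measurable M1" "k \<in> borel_measurable M2"
    unfolding h_def k_def by measurable
  have G1: "integrable ?P G"
    using square_integrable_imp_integrable[OF G G2] .
  have h2: "integrable M1 (\<lambda>x. (h x)\<^sup>2)" and k2: "integrable M2 (\<lambda>y. (k y)\<^sup>2)"
    unfolding h_def k_def using square_integrable_marginal_fst[OF G G2] square_integrable_marginal_snd .
  have h1: "integrable M1 h" and k1: "integrable M2 k"
    using M1.square_integrable_imp_integrable[OF _ h2] M2.square_integrable_imp_integrable[OF _ k2] by auto
  have hm: "(\<integral>x. h x \<partial>M1) = m"
    unfolding h_def m_def by (rule integral_fst'[OF G1])
  have km: "(\<integral>y. k y \<partial>M2) = m"
    unfolding k_def m_def using integral_snd[of "\<lambda>x y. G (x, y)"] G1 by simp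
  have Gh: "integrable ?P (\<lambda>p. G p * h (fst p))" "(\<integral>p. G p * h (fst p) \<partial>?P) = (\<integral>x. (h x)\<^sup>2 \<partial>M1)"
    unfolding h_def using integral_mult_marginal_fst[OF G G2] .
  have Gk: "integrable ?P (\<lambda>p. G p * k (snd p))" "(\<integral>p. G p * k (snd p) \<partial>?P) = (\<integral>y. (k y)\<^sup>2 \<partial>M2)"
    unfolding k_def using integral_mult_marginal_snd .
  have hk: "integrable ?P (\<lambda>p. h (fst p) * k (snd p))"
    by (rule integrable_mult_square_integrable)
      (use integrable_comp_fst(1)[OF h2] integrable_comp_snd(1)[OF k2] in auto)
  \<comment> \<open>Under the product measure \<open>h (fst p)\<close> and \<open>k (snd p)\<close>
    are independent, each with mean \<open>m\<close>.\<close>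
  have hk': "(\<integral>p. h (fst p) * k (snd p) \<partial>?P) = m\<^sup>2"
    using integral_fst'[OF hk] by (simp add: hm km power2_eq_square)
  note ints = G1 G2 Gh(1) Gk(1) hk integrable_comp_fst(1)[OF h1] integrable_comp_fst(1)[OF h2]
    integrable_comp_snd(1)[OF k1] integrable_comp_snd(1)[OF k2]
  have "0 \<le> (\<integral>p. (G p - h (fst p) - k (snd p) + m)\<^sup>2 \<partial>?P)"
    by simp
  also have "(\<lambda>p. (G p - h (fst p) - k (snd p) + m)\<^sup>2) =
    (\<lambda>p. (G p)\<^sup>2 + (h (fst p))\<^sup>2 + (k (snd p))\<^sup>2 + m\<^sup>2 - 2 * (G p * h (fst p)) - 2 * (G p * k (snd p))
      + 2 * (h (fst p) * k (snd p)) + 2 * m * G p - 2 * m * h (fst p) - 2 * m * k (snd p))"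
    by (auto simp: power2_eq_square algebra_simps)
  \<comment> \<open>The cross terms with \<open>G\<close> turn the signs of the squares of
    \<open>h\<close> and \<open>k\<close> negative, and the constants add up to a single
    \<open>m\<^sup>2\<close>.\<close>
  also have "(\<integral>p. \<dots> p \<partial>?P) = (\<integral>p. (G p)\<^sup>2 \<partial>?P) + (\<integral>x. (h x)\<^sup>2 \<partial>M1) + (\<integral>y. (k y)\<^sup>2 \<partial>M2) + m\<^sup>2
      - 2 * (\<integral>x. (h x)\<^sup>2 \<partial>M1) - 2 * (\<integral>y. (k y)\<^sup>2 \<partial>M2) + 2 * m\<^sup>2 + 2 * m * m - 2 * m * m - 2 * m * m"
    using ints Gh(2) Gk(2) hk' hm km integrable_comp_fst(2)[OF h1] integrable_comp_fst(2)[OF h2]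
      integrable_comp_snd(2)[OF k1] integrable_comp_snd(2)[OF k2] m_def[symmetric]
    by (simp add: prob_space)
  finally show ?thesis
    by (simp add: h_def k_def m_def power2_eq_square)
qed

end

end

section \<open>Splitting one coordinate off a product measure\<close>

lemma measurable_fun_upd_component:
  assumes "i \<in> I" "g \<in> measurable (Pi\<^sub>M I \<mu>) N"
  shows "(\<lambda>(x, z). g (x(i := z))) \<in> measurable (Pi\<^sub>M I \<mu> \<Otimes>\<^sub>M \<mu> i) N"
proof -
  \<comment> \<open>The map that adds a coordinate also overwrites one, because
    \<open>insert i I = I\<close> here.\<close>
  have "(\<lambda>(x, z). x(i := z)) \<in> measurable (Pi\<^sub>M I \<mu> \<Otimes>\<^sub>M \<mu> i) (Pi\<^sub>M I \<mu>)"
    using measurable_add_dim[of i I \<mu>] assms(1) by (simp add: insert_absorb)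
  from measurable_compose[OF this assms(2)] show ?thesis
    by (simp add: case_prod_unfold)
qed

lemma measurable_PiM_insert:
  "(\<lambda>p. (snd p)(i := fst p)) \<in> measurable (\<mu> i \<Otimes>\<^sub>M Pi\<^sub>M I \<mu>) (Pi\<^sub>M (insert i I) \<mu>)"
  by measurable

context
  fixes I :: "'i set" and i :: 'i and \<mu> :: "'i \<Rightarrow> 'a measure"
  assumes prob: "\<forall>j\<in>I. prob_space (\<mu> j)" and prob_i: "prob_space (\<mu> i)"
begin

lemma pair_prob_space_PiM: "pair_prob_space (\<mu> i) (Pi\<^sub>M I \<mu>)"
proof -
  interpret A: prob_space "\<mu> i" by (rule prob_i)
  interpret B: prob_space "Pi\<^sub>M I \<mu>" by (rule prob_space_PiM) (use prob in auto)
  show ?thesis ..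
qed

text \<open>This reduces integrals over \<open>insert i I\<close> to a product of two factors: the
  first component of the pair is written into coordinate \<open>i\<close> of the second.\<close>

lemma PiM_insert_eq_distr:
  "Pi\<^sub>M (insert i I) \<mu> = distr (\<mu> i \<Otimes>\<^sub>M Pi\<^sub>M I \<mu>) (Pi\<^sub>M (insert i I) \<mu>) (\<lambda>p. (snd p)(i := fst p))"
  using distr_pair_PiM_eq_PiM[of I \<mu> i] prob prob_i by (simp add: case_prod_unfold)

lemma
  fixes g :: "('i \<Rightarrow> 'a) \<Rightarrow> 'b :: {banach, second_countable_topology}"
  assumes g: "g \<in> borel_measurable (Pi\<^sub>M (insert i I) \<mu>)"
  shows integral_PiM_insert: "(\<integral>x. g x \<partial>Pi\<^sub>M (insert i I) \<mu>)
      = (\<integral>p. g ((snd p)(i := fst p)) \<partial>(\<mu> i \<Otimes>\<^sub>M Pi\<^sub>M I \<mu>))"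
    and integrable_PiM_insert: "integrable (Pi\<^sub>M (insert i I) \<mu>) g
      \<longleftrightarrow> integrable (\<mu> i \<Otimes>\<^sub>M Pi\<^sub>M I \<mu>) (\<lambda>p. g ((snd p)(i := fst p)))"
  using integral_distr[OF measurable_PiM_insert g] integrable_distr_eq[OF measurable_PiM_insert g]
  unfolding PiM_insert_eq_distr[symmetric] by simp_all

text \<open>The converse direction of Fubini for null sets: measurability of \<open>P\<close> allows
  passing from almost every slice to almost every pair, and the distribution identity carries this
  to the larger product.\<close>

lemma AE_PiM_insert:
  assumes P: "Measurable.pred (Pi\<^sub>M (insert i I) \<mu>) P"
    and AE: "AE y in \<mu> i. AE X in Pi\<^sub>M I \<mu>. P (X(i := y))"
  shows "AE x in Pi\<^sub>M (insert i I) \<mu>. P x"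
proof -
  interpret Q: pair_prob_space "\<mu> i" "Pi\<^sub>M I \<mu>" by (rule pair_prob_space_PiM)
  have "Measurable.pred (\<mu> i \<Otimes>\<^sub>M Pi\<^sub>M I \<mu>) (\<lambda>p. P ((snd p)(i := fst p)))"
    using measurable_compose[OF measurable_PiM_insert P] .
  then have "AE p in \<mu> i \<Otimes>\<^sub>M Pi\<^sub>M I \<mu>. P ((snd p)(i := fst p))"
    using AE by (intro Q.AE_pair_measure) (simp_all add: pred_def)
  then show ?thesis
    using P AE_distr_iff[OF measurable_PiM_insert[where i=i and I=I and \<mu>=\<mu>], of P]
    unfolding PiM_insert_eq_distr[symmetric] by (simp add: pred_def)
qed

end

section \<open>Averaging over a coordinate already present\<close>

context
  fixes I :: "'i set" and i :: 'i and \<mu> :: "'i \<Rightarrow> 'a measure"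
  assumes prob: "\<forall>j\<in>I. prob_space (\<mu> j)" and i: "i \<in> I"
begin

lemma borel_measurable_integral_component:
  fixes g :: "('i \<Rightarrow> 'a) \<Rightarrow> 'b :: {banach, second_countable_topology}"
  assumes g: "g \<in> borel_measurable (Pi\<^sub>M I \<mu>)"
  shows "(\<lambda>x. \<integral>z. g (x(i := z)) \<partial>\<mu> i) \<in> borel_measurable (Pi\<^sub>M I \<mu>)"
proof -
  interpret prob_space "\<mu> i" using prob i by blast
  show ?thesis
    by (rule borel_measurable_lebesgue_integral) (rule measurable_fun_upd_component[OF i g])
qed

text \<open>With \<open>I\<close> split into \<open>i\<close> and the rest, Fubini gives the claim
  for almost every point of the rest. It then lifts to the whole product, since the update forgets
  the old value at \<open>i\<close>.\<close>

lemma AE_integrable_component: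
  fixes g :: "('i \<Rightarrow> 'a) \<Rightarrow> 'b :: {banach, second_countable_topology}"
  assumes g: "integrable (Pi\<^sub>M I \<mu>) g"
  shows "AE x in Pi\<^sub>M I \<mu>. integrable (\<mu> i) (\<lambda>z. g (x(i := z)))"
proof -
  have eq: "insert i (I - {i}) = I" using i by auto
  have prob': "\<forall>j\<in>I - {i}. prob_space (\<mu> j)" and prob_i: "prob_space (\<mu> i)" using prob i by auto
  interpret Q: pair_prob_space "\<mu> i" "Pi\<^sub>M (I - {i}) \<mu>"
    by (rule pair_prob_space_PiM[OF prob' prob_i])
  interpret Q': pair_prob_space "Pi\<^sub>M (I - {i}) \<mu>" "\<mu> i" ..
  have gm: "g \<in> borel_measurable (Pi\<^sub>M I \<mu>)" using g by simp
  have "integrable (\<mu> i \<Otimes>\<^sub>M Pi\<^sub>M (I - {i}) \<mu>) (\<lambda>p. g ((snd p)(i := fst p)))"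
    using integrable_PiM_insert[of "I - {i}" \<mu> i, OF prob' prob_i, unfolded eq, OF gm] g by simp
  from Q'.AE_integrable_fst'[OF Q.integrable_product_swap[OF this]]
  have "AE x in Pi\<^sub>M (I - {i}) \<mu>. integrable (\<mu> i) (\<lambda>z. g (x(i := z)))"
    by simp
  \<comment> \<open>The outer update overwrites \<open>y\<close>, so the condition is the same for
    every \<open>y\<close>.\<close>
  then have AE: "AE y in \<mu> i. AE x in Pi\<^sub>M (I - {i}) \<mu>. integrable (\<mu> i) (\<lambda>z. g ((x(i := y))(i := z)))"
    by simp
  have "Measurable.pred (Pi\<^sub>M I \<mu>) (\<lambda>x. integrable (\<mu> i) (\<lambda>z. g (x(i := z))))"
    by (rule Q.M1.borel_measurable_lebesgue_integrable) (rule measurable_fun_upd_component[OF i gm])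
  from AE_PiM_insert[of "I - {i}" \<mu> i, OF prob' prob_i, unfolded eq, OF this] AE
  show ?thesis by simp
qed

text \<open>The average is the marginal of \<open>G\<close> over coordinate \<open>i\<close>,
  composed with the projection onto the remaining coordinates. Both operations preserve square
  integrability.\<close>

lemma square_integrable_integral_component:
  fixes g :: "('i \<Rightarrow> 'a) \<Rightarrow> real"
  assumes g: "g \<in> borel_measurable (Pi\<^sub>M I \<mu>)" and g2: "integrable (Pi\<^sub>M I \<mu>) (\<lambda>x. (g x)\<^sup>2)"
  shows "integrable (Pi\<^sub>M I \<mu>) (\<lambda>x. (\<integral>z. g (x(i := z)) \<partial>\<mu> i)\<^sup>2)"
proof -
  have eq: "insert i (I - {i}) = I" using i by auto
  have prob': "\<forall>j\<in>I - {i}. prob_space (\<mu> j)" and prob_i: "prob_space (\<mu> i)" using prob i by auto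
  note integrable_insert = integrable_PiM_insert[of "I - {i}" \<mu> i, OF prob' prob_i, unfolded eq]
  interpret Q: pair_prob_space "\<mu> i" "Pi\<^sub>M (I - {i}) \<mu>"
    by (rule pair_prob_space_PiM[OF prob' prob_i])
  define G where "G = (\<lambda>p. g ((snd p)(i := fst p)))"
  have G: "G \<in> borel_measurable (\<mu> i \<Otimes>\<^sub>M Pi\<^sub>M (I - {i}) \<mu>)"
    unfolding G_def
    using measurable_compose[OF measurable_PiM_insert[where I="I - {i}" and i=i and \<mu>=\<mu>, unfolded eq] g] .
  have "integrable (\<mu> i \<Otimes>\<^sub>M Pi\<^sub>M (I - {i}) \<mu>) (\<lambda>p. (G p)\<^sup>2)"
    unfolding G_def using g2 g integrable_insert[of "\<lambda>x. (g x)\<^sup>2"] by simp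
  from Q.integrable_comp_snd(1)[OF Q.square_integrable_marginal_snd[OF G this]]
  have "integrable (\<mu> i \<Otimes>\<^sub>M Pi\<^sub>M (I - {i}) \<mu>) (\<lambda>p. (\<integral>z. g (((snd p)(i := fst p))(i := z)) \<partial>\<mu> i)\<^sup>2)"
    by (simp add: G_def)
  then show ?thesis
    using integrable_insert[of "\<lambda>x. (\<integral>z. g (x(i := z)) \<partial>\<mu> i)\<^sup>2"]
      borel_measurable_integral_component[OF g] by simp
qed

end

section \<open>The scalar Efron--Stein inequality\<close>

theorem efron_stein:
  fixes g :: "('i \<Rightarrow> 'a) \<Rightarrow> real"
  assumes "finite I" "\<And>i. i \<in> I \<Longrightarrow> prob_space (\<mu> i)"
    and "g \<in> borel_measurable (Pi\<^sub>M I \<mu>)" "integrable (Pi\<^sub>M I \<mu>) (\<lambda>x. (g x)\<^sup>2)"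
  shows "(\<integral>x. (g x)\<^sup>2 \<partial>Pi\<^sub>M I \<mu>) - (\<integral>x. g x \<partial>Pi\<^sub>M I \<mu>)\<^sup>2
    \<le> (\<Sum>i\<in>I. \<integral>x. (g x - (\<integral>z. g (x(i := z)) \<partial>\<mu> i))\<^sup>2 \<partial>Pi\<^sub>M I \<mu>)"
  using assms
proof (induction I arbitrary: g rule: finite_induct)
  case empty
  \<comment> \<open>The product over no coordinates is a one-point space, so both sides
    vanish.\<close>
  show ?case by (simp add: PiM_empty lebesgue_integral_count_space_finite)
next
  case (insert i I)
  note g[measurable] = insert.prems(2) and g2 = insert.prems(3)
  let ?K = "Pi\<^sub>M (insert i I) \<mu>" and ?Q = "\<mu> i \<Otimes>\<^sub>M Pi\<^sub>M I \<mu>"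
  have prob: "\<forall>j\<in>insert i I. prob_space (\<mu> j)" using insert.prems(1) by blast
  then have probI: "\<forall>j\<in>I. prob_space (\<mu> j)" and probi: "prob_space (\<mu> i)" by auto
  note rules = integral_PiM_insert[of I \<mu> i, OF probI probi] integrable_PiM_insert[of I \<mu> i, OF probI probi]
  interpret Q: pair_prob_space "\<mu> i" "Pi\<^sub>M I \<mu>"
    by (rule pair_prob_space_PiM[OF probI probi])
  define G where "G = (\<lambda>p. g ((snd p)(i := fst p)))"
  have G[measurable]: "G \<in> borel_measurable ?Q"
    unfolding G_def using measurable_compose[OF measurable_PiM_insert g] .
  have G2: "integrable ?Q (\<lambda>p. (G p)\<^sup>2)"
    unfolding G_def using g2 rules(2)[of "\<lambda>x. (g x)\<^sup>2"] by simp
  define d where "d = (\<lambda>j x. (g x - (\<integral>z. g (x(j := z)) \<partial>\<mu> j))\<^sup>2)"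
  have d_meas: "d j \<in> borel_measurable ?K" and d_int: "integrable ?K (d j)" if "j \<in> insert i I" for j
    unfolding d_def
    using square_integrable_diff[OF g borel_measurable_integral_component[OF prob that g] g2
        square_integrable_integral_component[OF prob that g g2]]
      borel_measurable_integral_component[OF prob that g] g
    by measurable
  have d_eq: "(\<integral>x. d j x \<partial>?K) = (\<integral>p. d j ((snd p)(i := fst p)) \<partial>?Q)"
    and d_int': "integrable ?Q (\<lambda>p. d j ((snd p)(i := fst p)))" if "j \<in> insert i I" for j
    using rules[of "d j"] d_meas d_int that by auto
  have d_i: "(\<integral>x. d i x \<partial>?K) = (\<integral>p. (G p)\<^sup>2 \<partial>?Q) - (\<integral>X. (\<integral>y. G (y, X) \<partial>\<mu> i)\<^sup>2 \<partial>Pi\<^sub>M I \<mu>)"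
    using d_eq[of i] Q.integral_square_diff_marginal_snd[OF G G2] by (simp add: d_def G_def)
  \<comment> \<open>Updates at \<open>i\<close> and \<open>j\<close> commute because
    \<open>i\<close> is not in \<open>I\<close>. Hence fixing coordinate \<open>i\<close> to
    \<open>y\<close> turns the integrand for \<open>j\<close> into the corresponding one for the
    slice \<open>\<lambda>X. G (y, X)\<close>.\<close>
  have d_I: "d j (X(i := y)) = (G (y, X) - (\<integral>z. G (y, X(j := z)) \<partial>\<mu> j))\<^sup>2" if "j \<in> I" for j X y
  proof -
    have "X(i := y, j := z) = X(j := z, i := y)" for z
      using that insert.hyps by (intro fun_upd_twist) auto
    then show ?thesis by (simp add: d_def G_def)
  qed
  \<comment> \<open>The left side is the mean over \<open>y\<close> of the variances of the slices,
    to which the induction hypothesis applies.\<close>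
  have "(\<integral>p. (G p)\<^sup>2 \<partial>?Q) - (\<integral>y. (\<integral>X. G (y, X) \<partial>Pi\<^sub>M I \<mu>)\<^sup>2 \<partial>\<mu> i)
      = (\<integral>y. (\<integral>X. (G (y, X))\<^sup>2 \<partial>Pi\<^sub>M I \<mu>) - (\<integral>X. G (y, X) \<partial>Pi\<^sub>M I \<mu>)\<^sup>2 \<partial>\<mu> i)"
    using Q.integral_fst'[OF G2] Q.integrable_fst'[OF G2] Q.square_integrable_marginal_fst[OF G G2]
    by simp
  also have "\<dots> \<le> (\<integral>y. (\<Sum>j\<in>I. \<integral>X. d j (X(i := y)) \<partial>Pi\<^sub>M I \<mu>) \<partial>\<mu> i)"
  proof (rule integral_mono_AE)
    show "integrable (\<mu> i) (\<lambda>y. (\<integral>X. (G (y, X))\<^sup>2 \<partial>Pi\<^sub>M I \<mu>) - (\<integral>X. G (y, X) \<partial>Pi\<^sub>M I \<mu>)\<^sup>2)"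
      using Q.integrable_fst'[OF G2] Q.square_integrable_marginal_fst[OF G G2] by simp
    show "integrable (\<mu> i) (\<lambda>y. \<Sum>j\<in>I. \<integral>X. d j (X(i := y)) \<partial>Pi\<^sub>M I \<mu>)"
      using Q.integrable_fst'[OF d_int'] by (auto intro!: Bochner_Integration.integrable_sum)
    show "AE y in \<mu> i. (\<integral>X. (G (y, X))\<^sup>2 \<partial>Pi\<^sub>M I \<mu>) - (\<integral>X. G (y, X) \<partial>Pi\<^sub>M I \<mu>)\<^sup>2
        \<le> (\<Sum>j\<in>I. \<integral>X. d j (X(i := y)) \<partial>Pi\<^sub>M I \<mu>)"
      using Q.AE_integrable_fst'[OF G2] AE_space
    proof eventually_elim
      case (elim y)
      have "(\<lambda>X. G (y, X)) \<in> borel_measurable (Pi\<^sub>M I \<mu>)"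
        using elim by measurable
      then have "(\<integral>X. (G (y, X))\<^sup>2 \<partial>Pi\<^sub>M I \<mu>) - (\<integral>X. G (y, X) \<partial>Pi\<^sub>M I \<mu>)\<^sup>2
          \<le> (\<Sum>j\<in>I. \<integral>X. (G (y, X) - (\<integral>z. G (y, X(j := z)) \<partial>\<mu> j))\<^sup>2 \<partial>Pi\<^sub>M I \<mu>)"
        using probI elim(1) by (intro insert.IH) auto
      then show ?case
        by (simp add: d_I)
    qed
  qed
  also have "\<dots> = (\<Sum>j\<in>I. \<integral>y. \<integral>X. d j (X(i := y)) \<partial>Pi\<^sub>M I \<mu> \<partial>\<mu> i)"
    using Q.integrable_fst'[OF d_int'] by (intro Bochner_Integration.integral_sum) auto
  also have "\<dots> = (\<Sum>j\<in>I. \<integral>x. d j x \<partial>?K)"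
    using Q.integral_fst'[OF d_int'] d_eq by (intro sum.cong) auto
  finally have "(\<integral>p. (G p)\<^sup>2 \<partial>?Q) - (\<integral>y. (\<integral>X. G (y, X) \<partial>Pi\<^sub>M I \<mu>)\<^sup>2 \<partial>\<mu> i) \<le> (\<Sum>j\<in>I. \<integral>x. d j x \<partial>?K)" .
  \<comment> \<open>By \<open>marginal_squares_le\<close> the variance of \<open>G\<close> is at
    most the sum of its two mean conditional variances. One of them equals the term of
    \<open>i\<close>, the other was just bounded by the terms of \<open>I\<close>.\<close>
  then have "(\<integral>p. (G p)\<^sup>2 \<partial>?Q) - (\<integral>p. G p \<partial>?Q)\<^sup>2 \<le> (\<integral>x. d i x \<partial>?K) + (\<Sum>j\<in>I. \<integral>x. d j x \<partial>?K)"
    using Q.marginal_squares_le[OF G G2] d_i by linarith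
  moreover have "(\<integral>x. (g x)\<^sup>2 \<partial>?K) = (\<integral>p. (G p)\<^sup>2 \<partial>?Q)" "(\<integral>x. g x \<partial>?K) = (\<integral>p. G p \<partial>?Q)"
    using rules(1)[of g] rules(1)[of "\<lambda>x. (g x)\<^sup>2"] by (simp_all add: G_def)
  ultimately have "(\<integral>x. (g x)\<^sup>2 \<partial>?K) - (\<integral>x. g x \<partial>?K)\<^sup>2 \<le> (\<Sum>j\<in>insert i I. \<integral>x. d j x \<partial>?K)"
    using insert.hyps by simp
  then show ?case
    unfolding d_def .
qed

section \<open>Complex square-integrable functions and the complex Efron--Stein inequality\<close>

lemma
  assumes "in_L2 M g"
  shows in_L2_measurable: "g \<in> borel_measurable M"
    and in_L2_norm_square: "integrable M (\<lambda>x. (norm (g x))\<^sup>2)"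
  using assms unfolding in_L2_def by auto

lemma in_L2_mult_integrable:
  assumes f: "in_L2 M f" and g: "in_L2 M g"
  shows "integrable M (\<lambda>x. f x * g x)"
proof -
  note [measurable] = in_L2_measurable[OF f] in_L2_measurable[OF g]
  have "integrable M (\<lambda>x. norm (f x) * norm (g x))"
    by (rule integrable_mult_square_integrable[OF _ _ in_L2_norm_square[OF f] in_L2_norm_square[OF g]])
      measurable
  then show ?thesis
    by (rule Bochner_Integration.integrable_bound) (simp_all add: norm_mult)
qed

lemma in_L2_bound:
  assumes "integrable M h" "g \<in> borel_measurable M" "\<And>x. (norm (g x))\<^sup>2 \<le> h x"
  shows "in_L2 M g"
proof -
  have [measurable]: "g \<in> borel_measurable M" by fact
  have "norm ((norm (g x))\<^sup>2) \<le> norm (h x)" for x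
    using assms(3)[of x] by simp
  then show ?thesis
    unfolding in_L2_def by (auto intro!: Bochner_Integration.integrable_bound[OF assms(1)])
qed

lemma in_L2_cmult: "in_L2 M g \<Longrightarrow> in_L2 M (\<lambda>x. c * g x)"
  by (auto simp: in_L2_def norm_mult power_mult_distrib)

lemma in_L2_add:
  assumes "in_L2 M f" "in_L2 M g"
  shows "in_L2 M (\<lambda>x. f x + g x)"
proof (rule in_L2_bound)
  show "integrable M (\<lambda>x. 2 * (norm (f x))\<^sup>2 + 2 * (norm (g x))\<^sup>2)"
    and "(\<lambda>x. f x + g x) \<in> borel_measurable M"
    using assms by (auto simp: in_L2_def)
  fix x
  have "(norm (f x + g x))\<^sup>2 \<le> (norm (f x) + norm (g x))\<^sup>2"
    by (intro power_mono norm_triangle_ineq) simp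
  also have "\<dots> \<le> 2 * (norm (f x))\<^sup>2 + 2 * (norm (g x))\<^sup>2"
    using sum_squares_bound[of "norm (f x)" "norm (g x)"] by (simp add: power2_sum)
  finally show "(norm (f x + g x))\<^sup>2 \<le> 2 * (norm (f x))\<^sup>2 + 2 * (norm (g x))\<^sup>2" .
qed

lemma in_L2_diff:
  assumes "in_L2 M f" "in_L2 M g"
  shows "in_L2 M (\<lambda>x. f x - g x)"
  using in_L2_add[OF assms(1) in_L2_cmult[OF assms(2), of "-1"]] by simp

lemma in_L2_sum:
  assumes "\<And>k. k \<in> K \<Longrightarrow> in_L2 M (g k)"
  shows "in_L2 M (\<lambda>x. \<Sum>k\<in>K. g k x)"
  using assms
proof (induction K rule: infinite_finite_induct)
  case (insert k K)
  then show ?case using in_L2_add[of M "g k"] by simp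
qed (auto simp: in_L2_def)

lemma in_L2_Re_Im:
  assumes "in_L2 M g"
  shows "integrable M (\<lambda>x. (Re (g x))\<^sup>2)" "integrable M (\<lambda>x. (Im (g x))\<^sup>2)"
proof -
  have [measurable]: "g \<in> borel_measurable M" and int: "integrable M (\<lambda>x. (norm (g x))\<^sup>2)"
    using assms by (simp_all add: in_L2_def)
  show "integrable M (\<lambda>x. (Re (g x))\<^sup>2)" "integrable M (\<lambda>x. (Im (g x))\<^sup>2)"
    by (rule Bochner_Integration.integrable_bound[OF int]; simp add: cmod_power2)+
qed

text \<open>The constant \<open>1\<close> is square-integrable for a probability measure, so
  \<open>g = g * 1\<close> is a product of two such functions.\<close>

lemma (in prob_space) in_L2_integrable: "in_L2 M g \<Longrightarrow> integrable M g"
  using in_L2_mult_integrable[of M g "\<lambda>_. 1"] by (simp add: in_L2_def[of M "\<lambda>_. 1"])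

text \<open>The real case, applied to the norm of \<open>g\<close>, supplies a dominating function.
  The norm bound holds at every \<open>x\<close>, since the Bochner integral is 0 on a slice that is
  not integrable.\<close>

lemma in_L2_integral_component:
  fixes \<mu> :: "'i \<Rightarrow> 'a measure"
  assumes prob: "\<forall>j\<in>I. prob_space (\<mu> j)" and i: "i \<in> I" and g: "in_L2 (Pi\<^sub>M I \<mu>) g"
  shows "in_L2 (Pi\<^sub>M I \<mu>) (\<lambda>x. \<integral>z. g (x(i := z)) \<partial>\<mu> i)"
proof (rule in_L2_bound)
  show "integrable (Pi\<^sub>M I \<mu>) (\<lambda>x. (\<integral>z. norm (g (x(i := z))) \<partial>\<mu> i)\<^sup>2)"
    by (rule square_integrable_integral_component[OF prob i _ in_L2_norm_square[OF g]])
      (use in_L2_measurable[OF g] in measurable)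
  show "(\<lambda>x. \<integral>z. g (x(i := z)) \<partial>\<mu> i) \<in> borel_measurable (Pi\<^sub>M I \<mu>)"
    by (rule borel_measurable_integral_component[OF prob i in_L2_measurable[OF g]])
qed (intro power_mono integral_norm_bound norm_ge_zero)

theorem efron_stein_complex:
  fixes \<mu> :: "'i \<Rightarrow> 'a measure"
  assumes "finite I" and prob: "\<forall>i\<in>I. prob_space (\<mu> i)" and g: "in_L2 (Pi\<^sub>M I \<mu>) g"
  shows "(\<integral>x. (norm (g x))\<^sup>2 \<partial>Pi\<^sub>M I \<mu>) - (norm (\<integral>x. g x \<partial>Pi\<^sub>M I \<mu>))\<^sup>2
    \<le> (\<Sum>i\<in>I. \<integral>x. (norm (g x - (\<integral>z. g (x(i := z)) \<partial>\<mu> i)))\<^sup>2 \<partial>Pi\<^sub>M I \<mu>)"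
proof -
  let ?P = "Pi\<^sub>M I \<mu>"
  interpret prob_space ?P by (rule prob_space_PiM) (use prob in auto)
  note gm [measurable] = in_L2_measurable[OF g] and gi = in_L2_integrable[OF g]
  have Re_gm: "(\<lambda>x. Re (g x)) \<in> borel_measurable ?P" and Im_gm: "(\<lambda>x. Im (g x)) \<in> borel_measurable ?P"
    by measurable
  define E where "E = (\<lambda>i x. \<integral>z. g (x(i := z)) \<partial>\<mu> i)"
  \<comment> \<open>\<open>D u i\<close> is the Dirichlet term of the real function
    \<open>u \<circ> g\<close>, used with \<open>u\<close> being \<open>Re\<close> or
    \<open>Im\<close>.\<close>
  define D where "D = (\<lambda>(u :: complex \<Rightarrow> real) i. \<integral>x. (u (g x) - (\<integral>z. u (g (x(i := z))) \<partial>\<mu> i))\<^sup>2 \<partial>?P)"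
  have L2: "in_L2 ?P (\<lambda>x. g x - E i x)" if "i \<in> I" for i
    unfolding E_def by (rule in_L2_diff[OF g in_L2_integral_component[OF prob that g]])
  \<comment> \<open>Taking real or imaginary parts commutes with the inner integral where the slice
    is integrable, which is the case for almost every \<open>x\<close>.\<close>
  have D: "D Re i + D Im i = (\<integral>x. (norm (g x - E i x))\<^sup>2 \<partial>?P)" if "i \<in> I" for i
  proof -
    have ae: "AE x in ?P. integrable (\<mu> i) (\<lambda>z. g (x(i := z)))"
      by (rule AE_integrable_component[OF prob that gi])
    have [measurable]: "E i \<in> borel_measurable ?P"
      unfolding E_def by (rule borel_measurable_integral_component[OF prob that gm])
    have "D Re i = (\<integral>x. (Re (g x - E i x))\<^sup>2 \<partial>?P)"
      unfolding D_def
    proof (rule integral_cong_AE)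
      show "(\<lambda>x. (Re (g x) - (\<integral>z. Re (g (x(i := z))) \<partial>\<mu> i))\<^sup>2) \<in> borel_measurable ?P"
        using borel_measurable_integral_component[OF prob that Re_gm] by measurable
      show "AE x in ?P. (Re (g x) - (\<integral>z. Re (g (x(i := z))) \<partial>\<mu> i))\<^sup>2 = (Re (g x - E i x))\<^sup>2"
        using ae by eventually_elim (simp add: E_def)
    qed measurable
    moreover have "D Im i = (\<integral>x. (Im (g x - E i x))\<^sup>2 \<partial>?P)"
      unfolding D_def
    proof (rule integral_cong_AE)
      show "(\<lambda>x. (Im (g x) - (\<integral>z. Im (g (x(i := z))) \<partial>\<mu> i))\<^sup>2) \<in> borel_measurable ?P"
        using borel_measurable_integral_component[OF prob that Im_gm] by measurable
      show "AE x in ?P. (Im (g x) - (\<integral>z. Im (g (x(i := z))) \<partial>\<mu> i))\<^sup>2 = (Im (g x - E i x))\<^sup>2"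
        using ae by eventually_elim (simp add: E_def)
    qed measurable
    ultimately show ?thesis
      using in_L2_Re_Im[OF L2[OF that]] by (simp add: cmod_power2)
  qed
  have "(\<integral>x. (Re (g x))\<^sup>2 \<partial>?P) - (\<integral>x. Re (g x) \<partial>?P)\<^sup>2 \<le> (\<Sum>i\<in>I. D Re i)"
    unfolding D_def by (rule efron_stein[OF assms(1) bspec[OF prob] Re_gm in_L2_Re_Im(1)[OF g]])
  moreover have "(\<integral>x. (Im (g x))\<^sup>2 \<partial>?P) - (\<integral>x. Im (g x) \<partial>?P)\<^sup>2 \<le> (\<Sum>i\<in>I. D Im i)"
    unfolding D_def by (rule efron_stein[OF assms(1) bspec[OF prob] Im_gm in_L2_Re_Im(2)[OF g]])
  moreover have "(\<integral>x. (norm (g x))\<^sup>2 \<partial>?P) = (\<integral>x. (Re (g x))\<^sup>2 \<partial>?P) + (\<integral>x. (Im (g x))\<^sup>2 \<partial>?P)"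
    using in_L2_Re_Im[OF g] by (simp add: cmod_power2)
  moreover have "(norm (\<integral>x. g x \<partial>?P))\<^sup>2 = (\<integral>x. Re (g x) \<partial>?P)\<^sup>2 + (\<integral>x. Im (g x) \<partial>?P)\<^sup>2"
    using gi by (simp add: cmod_power2)
  moreover have "(\<Sum>i\<in>I. D Re i) + (\<Sum>i\<in>I. D Im i) = (\<Sum>i\<in>I. \<integral>x. (norm (g x - E i x))\<^sup>2 \<partial>?P)"
    unfolding sum.distrib[symmetric] by (intro sum.cong refl D)
  ultimately show ?thesis
    unfolding E_def by linarith
qed

section \<open>Hermitian matrices and their quadratic forms\<close>

definition quadratic_form :: "complex ^ 'd \<Rightarrow> complex ^ 'd ^ 'd \<Rightarrow> real" where
  "quadratic_form v A = Re (\<Sum>i\<in>UNIV. cnj (v $ i) * (A *v v) $ i)"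

text \<open>This exhibits the form as real-linear in the entries of \<open>A\<close>; additivity and
  the exchange with entrywise integrals follow.\<close>

lemma quadratic_form_expand:
  "quadratic_form v A = Re (\<Sum>i\<in>UNIV. \<Sum>j\<in>UNIV. cnj (v $ i) * v $ j * A $ i $ j)"
  by (simp add: quadratic_form_def matrix_vector_mult_def sum_distrib_left mult_ac)

lemma quadratic_form_diff: "quadratic_form v (A - B) = quadratic_form v A - quadratic_form v B"
  by (simp add: quadratic_form_expand sum_subtractf algebra_simps)

lemma quadratic_form_add: "quadratic_form v (A + B) = quadratic_form v A + quadratic_form v B"
  by (simp add: quadratic_form_expand sum.distrib algebra_simps)

lemma quadratic_form_sum: "quadratic_form v (\<Sum>k\<in>K. A k) = (\<Sum>k\<in>K. quadratic_form v (A k))"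
proof (rule sum_comp_morphism[unfolded comp_def, symmetric])
  show "quadratic_form v 0 = 0"
    by (simp add: quadratic_form_expand)
qed (rule quadratic_form_add)

text \<open>With \<open>cnj\<close> on the left the equation can serve as a rewrite rule, while in
  the defining orientation it would loop.\<close>

lemma hermitian_mats_iff: "A \<in> hermitian_mats \<longleftrightarrow> (\<forall>i j. cnj (A $ i $ j) = A $ j $ i)"
  unfolding hermitian_mats_def mem_Collect_eq by (rule iffI; intro allI; rule sym; blast)

text \<open>One factor \<open>A\<close> moves to the conjugated side of the inner product,
  \<open>A\<close> being its own adjoint.\<close>

lemma quadratic_form_mat_sq:
  assumes "A \<in> hermitian_mats"
  shows "quadratic_form v (mat_sq A) = (\<Sum>k\<in>UNIV. (norm ((A *v v) $ k))\<^sup>2)"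
proof -
  have A: "cnj (A $ i $ k) = A $ k $ i" for i k
    using assms by (simp add: hermitian_mats_iff)
  let ?w = "A *v v"
  have "(\<Sum>i\<in>UNIV. cnj (v $ i) * (mat_sq A *v v) $ i)
      = (\<Sum>i\<in>UNIV. \<Sum>k\<in>UNIV. cnj (v $ i) * (A $ i $ k * ?w $ k))"
    unfolding mat_sq_def matrix_vector_mul_assoc[symmetric]
    by (simp add: matrix_vector_mult_def[of A ?w] sum_distrib_left)
  also have "\<dots> = (\<Sum>k\<in>UNIV. \<Sum>i\<in>UNIV. cnj (v $ i) * (A $ i $ k * ?w $ k))"
    by (rule sum.swap)
  also have "\<dots> = (\<Sum>k\<in>UNIV. cnj (?w $ k) * ?w $ k)"
  proof (rule sum.cong[OF refl])
    fix k
    have "cnj (?w $ k) = (\<Sum>i\<in>UNIV. cnj (v $ i) * A $ i $ k)"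
      by (simp add: matrix_vector_mult_def A mult.commute)
    then show "(\<Sum>i\<in>UNIV. cnj (v $ i) * (A $ i $ k * ?w $ k)) = cnj (?w $ k) * ?w $ k"
      by (simp add: sum_distrib_right mult.assoc)
  qed
  also have "\<dots> = (\<Sum>k\<in>UNIV. of_real ((norm (?w $ k))\<^sup>2))"
    by (intro sum.cong refl) (simp add: complex_norm_square[symmetric] mult.commute)
  finally show ?thesis
    unfolding quadratic_form_def by (simp flip: of_real_sum of_real_power)
qed

lemma hermitian_mats_mat_sq: "A \<in> hermitian_mats \<Longrightarrow> mat_sq A \<in> hermitian_mats"
  by (simp add: hermitian_mats_iff mat_sq_def matrix_matrix_mult_def mult.commute)

lemma hermitian_mats_diff:
  "A \<in> hermitian_mats \<Longrightarrow> B \<in> hermitian_mats \<Longrightarrow> A - B \<in> hermitian_mats"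
  by (simp add: hermitian_mats_iff)

lemma hermitian_mats_sum:
  "(\<And>k. k \<in> K \<Longrightarrow> A k \<in> hermitian_mats) \<Longrightarrow> (\<Sum>k\<in>K. A k) \<in> hermitian_mats"
  by (simp add: hermitian_mats_iff)

text \<open>Conjugation commutes with the Bochner integral even where the latter takes its default
  value 0, so the averages over every slice are Hermitian, not just over almost every one.\<close>

lemma hermitian_mats_mat_integral:
  assumes "\<And>x. x \<in> space M \<Longrightarrow> F x \<in> hermitian_mats"
  shows "mat_integral M F \<in> hermitian_mats"
proof -
  have "cnj (\<integral>x. F x $ i $ j \<partial>M) = (\<integral>x. F x $ j $ i \<partial>M)" for i j
    unfolding Bochner_Integration.integral_cnj[symmetric] using assms
    by (intro Bochner_Integration.integral_cong) (auto simp: hermitian_mats_iff)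
  then show ?thesis
    by (simp add: hermitian_mats_iff mat_integral_def)
qed

lemma quadratic_form_mat_integral:
  assumes "\<And>i j. integrable M (\<lambda>x. F x $ i $ j)"
  shows "quadratic_form v (mat_integral M F) = (\<integral>x. quadratic_form v (F x) \<partial>M)"
  using assms by (simp add: quadratic_form_expand mat_integral_def)

lemma mat_integral_mult_vec:
  assumes "\<And>i j. integrable M (\<lambda>x. F x $ i $ j)"
  shows "(mat_integral M F *v v) $ k = (\<integral>x. (F x *v v) $ k \<partial>M)"
  using assms by (simp add: matrix_vector_mult_def mat_integral_def)

lemma in_L2_mult_vec:
  assumes "\<And>i j. in_L2 M (\<lambda>x. F x $ i $ j)"
  shows "in_L2 M (\<lambda>x. (F x *v v) $ k)"
proof -
  have "in_L2 M (\<lambda>x. \<Sum>j\<in>UNIV. v $ j * F x $ k $ j)"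
    by (intro in_L2_sum in_L2_cmult assms)
  then show ?thesis by (simp add: matrix_vector_mult_def mult.commute)
qed

text \<open>Entries of \<open>mat_sq (F x)\<close> are finite sums of products of square-integrable
  functions, hence integrable, and so the form may be taken under the integral. This serves both the
  second moment of \<open>f\<close> and each Dirichlet term.\<close>

lemma quadratic_form_integral_mat_sq:
  assumes herm: "\<And>x. x \<in> space M \<Longrightarrow> F x \<in> hermitian_mats"
    and L2: "\<And>i j. in_L2 M (\<lambda>x. F x $ i $ j)"
  shows "quadratic_form v (mat_integral M (\<lambda>x. mat_sq (F x)))
    = (\<Sum>k\<in>UNIV. \<integral>x. (norm ((F x *v v) $ k))\<^sup>2 \<partial>M)"
proof -
  have "quadratic_form v (mat_integral M (\<lambda>x. mat_sq (F x))) = (\<integral>x. quadratic_form v (mat_sq (F x)) \<partial>M)"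
    unfolding mat_sq_def matrix_matrix_mult_def
    by (rule quadratic_form_mat_integral)
      (simp add: in_L2_mult_integrable[OF L2 L2])
  also have "\<dots> = (\<integral>x. (\<Sum>k\<in>UNIV. (norm ((F x *v v) $ k))\<^sup>2) \<partial>M)"
    using herm by (intro Bochner_Integration.integral_cong) (auto simp: quadratic_form_mat_sq)
  also have "\<dots> = (\<Sum>k\<in>UNIV. \<integral>x. (norm ((F x *v v) $ k))\<^sup>2 \<partial>M)"
    using in_L2_mult_vec[of M F, OF L2, unfolded in_L2_def]
    by (intro Bochner_Integration.integral_sum) blast
  finally show ?thesis .
qed

section \<open>The matrix inequality\<close>

theorem theorem5p3:
  fixes n :: nat
    and \<mu> :: "nat \<Rightarrow> 'a :: polish_space measure"
    and f :: "(nat \<Rightarrow> 'a) \<Rightarrow> complex ^ 'd ^ 'd"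
  assumes prob: "\<And>i. i \<in> {1..n} \<Longrightarrow> prob_space (\<mu> i)"
    and borel: "\<And>i. i \<in> {1..n} \<Longrightarrow> sets (\<mu> i) = sets borel"
    and herm: "\<And>x. x \<in> {1..n} \<rightarrow>\<^sub>E UNIV \<Longrightarrow> f x \<in> hermitian_mats"
    and L2: "\<And>j k. in_L2 (Pi\<^sub>M {1..n} \<mu>) (\<lambda>x. f x $ j $ k)"
  shows "mat_var (Pi\<^sub>M {1..n} \<mu>) f \<preceq> mat_dirichlet n \<mu> f"
proof -
  let ?P = "Pi\<^sub>M {1..n} \<mu>"
  define E where "E = (\<lambda>i x. mat_integral (\<mu> i) (\<lambda>z. f (x(i := z))))"
  have prob': "\<forall>i\<in>{1..n}. prob_space (\<mu> i)" using prob by blast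
  interpret prob_space ?P by (rule prob_space_PiM) (rule prob)
  \<comment> \<open>Borel sets force each factor to live on the whole type, so the points of
    \<open>?P\<close> are exactly those where \<open>f\<close> is known to be Hermitian.\<close>
  have space_\<mu>: "space (\<mu> i) = UNIV" if "i \<in> {1..n}" for i
    using sets_eq_imp_space_eq[OF borel[OF that]] by simp
  have space_P: "space ?P = {1..n} \<rightarrow>\<^sub>E UNIV"
    by (auto simp: space_PiM space_\<mu> intro!: PiE_cong)
  have int: "integrable ?P (\<lambda>x. f x $ j $ k)" for j k
    using in_L2_integrable[OF L2] .
  have herm_P: "f x \<in> hermitian_mats" if "x \<in> space ?P" for x
    using herm that space_P by simp
  have herm_E: "f x - E i x \<in> hermitian_mats" if "x \<in> space ?P" "i \<in> {1..n}" for x i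
    unfolding E_def
  proof (intro hermitian_mats_diff hermitian_mats_mat_integral)
    show "f x \<in> hermitian_mats" using herm_P that(1) .
    show "f (x(i := z)) \<in> hermitian_mats" for z
      using that unfolding space_P by (intro herm) (auto simp: PiE_iff extensional_def)
  qed
  have L2_E: "in_L2 ?P (\<lambda>x. (f x - E i x) $ j $ k)" if "i \<in> {1..n}" for i j k
    using in_L2_diff[OF L2 in_L2_integral_component[OF prob' that L2]]
    by (simp add: E_def mat_integral_def)
  have dirichlet: "mat_dirichlet n \<mu> f = (\<Sum>i = 1..n. mat_integral ?P (\<lambda>x. mat_sq (f x - E i x)))"
    by (simp add: mat_dirichlet_def E_def)
  have herm_var: "mat_var ?P f \<in> hermitian_mats"
    unfolding mat_var_def
    by (intro hermitian_mats_diff hermitian_mats_mat_integral hermitian_mats_mat_sq herm_P)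
  have herm_dirichlet: "mat_dirichlet n \<mu> f \<in> hermitian_mats"
    unfolding dirichlet
    by (intro hermitian_mats_sum hermitian_mats_mat_integral hermitian_mats_mat_sq herm_E)
  have "quadratic_form v (mat_var ?P f) \<le> quadratic_form v (mat_dirichlet n \<mu> f)" for v
  proof -
    define g where "g = (\<lambda>k x. (f x *v v) $ k)"
    have g: "in_L2 ?P (g k)" for k
      unfolding g_def by (rule in_L2_mult_vec[OF L2])
    \<comment> \<open>Multiplication by \<open>v\<close> passes through the inner average once all
      entries of the slice are integrable. As there are finitely many entries, this holds
      simultaneously for almost every \<open>x\<close>.\<close>
    have slice: "(\<integral>x. (norm (((f x - E i x) *v v) $ k))\<^sup>2 \<partial>?P)
        = (\<integral>x. (norm (g k x - (\<integral>z. g k (x(i := z)) \<partial>\<mu> i)))\<^sup>2 \<partial>?P)" if i: "i \<in> {1..n}" for i k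
    proof (rule integral_cong_AE)
      show "(\<lambda>x. (norm (((f x - E i x) *v v) $ k))\<^sup>2) \<in> borel_measurable ?P"
        by (rule borel_measurable_integrable[OF in_L2_norm_square[OF in_L2_mult_vec[OF L2_E[OF i]]]])
      show "(\<lambda>x. (norm (g k x - (\<integral>z. g k (x(i := z)) \<partial>\<mu> i)))\<^sup>2) \<in> borel_measurable ?P"
        by (rule borel_measurable_integrable[OF in_L2_norm_square[OF
              in_L2_diff[OF g in_L2_integral_component[OF prob' i g]]]])
      have "AE x in ?P. \<forall>j k. integrable (\<mu> i) (\<lambda>z. f (x(i := z)) $ j $ k)"
        using AE_integrable_component[OF prob' i int] by (simp add: AE_all_countable)
      then show "AE x in ?P. (norm (((f x - E i x) *v v) $ k))\<^sup>2
          = (norm (g k x - (\<integral>z. g k (x(i := z)) \<partial>\<mu> i)))\<^sup>2"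
      proof eventually_elim
        case (elim x)
        then show ?case
          using mat_integral_mult_vec[of "\<mu> i" "\<lambda>z. f (x(i := z))" v k]
          by (simp add: g_def E_def matrix_vector_mult_diff_rdistrib)
      qed
    qed
    have "quadratic_form v (mat_var ?P f)
        = (\<Sum>k\<in>UNIV. (\<integral>x. (norm (g k x))\<^sup>2 \<partial>?P) - (norm (\<integral>x. g k x \<partial>?P))\<^sup>2)"
    proof -
      have "quadratic_form v (mat_integral ?P (\<lambda>x. mat_sq (f x))) = (\<Sum>k\<in>UNIV. \<integral>x. (norm (g k x))\<^sup>2 \<partial>?P)"
        unfolding g_def by (intro quadratic_form_integral_mat_sq herm_P L2)
      \<comment> \<open>The mean of \<open>f\<close> is itself Hermitian, so the formula for the
        form of a square applies to it too.\<close>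
      moreover have "quadratic_form v (mat_sq (mat_integral ?P f)) = (\<Sum>k\<in>UNIV. (norm (\<integral>x. g k x \<partial>?P))\<^sup>2)"
        unfolding g_def mat_integral_mult_vec[OF int, symmetric]
        by (intro quadratic_form_mat_sq hermitian_mats_mat_integral herm_P)
      ultimately show ?thesis
        by (simp add: mat_var_def quadratic_form_diff sum_subtractf)
    qed
    \<comment> \<open>The complex inequality is used once for each component \<open>k\<close> of
      \<open>f x *v v\<close>.\<close>
    also have "\<dots> \<le> (\<Sum>k\<in>UNIV. \<Sum>i = 1..n. \<integral>x. (norm (g k x - (\<integral>z. g k (x(i := z)) \<partial>\<mu> i)))\<^sup>2 \<partial>?P)"
      by (rule sum_mono) (rule efron_stein_complex[OF finite_atLeastAtMost prob' g])
    also have "\<dots> = (\<Sum>i = 1..n. \<Sum>k\<in>UNIV. \<integral>x. (norm (((f x - E i x) *v v) $ k))\<^sup>2 \<partial>?P)"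
      by (subst sum.swap) (intro sum.cong refl slice[symmetric])
    also have "\<dots> = quadratic_form v (mat_dirichlet n \<mu> f)"
      unfolding dirichlet quadratic_form_sum
      by (intro sum.cong refl quadratic_form_integral_mat_sq[symmetric] herm_E L2_E)
    finally show ?thesis .
  qed
  then show ?thesis
    unfolding psd_le_def pos_semidef_def quadratic_form_def[symmetric] quadratic_form_diff
    using herm_var herm_dirichlet hermitian_mats_diff[OF herm_dirichlet herm_var] by simp
qed

end
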